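(* Let $K$ be a finitely generated abelian group, let $H$ be a finite group, and let $G$ be an extension of $H$ by $K$, i.e. a group fitting into a short exact sequence $1\to H\to G\to K\to 1$. Then there exists a finite symmetric generating set $A$ of $G$ such that the geodesic language $\mathsf{Geo}(G,A)$ is piecewise excluding.
   Context: A generating set $A$ of a group $G$ is symmetric if it is inverse-closed: $A$ is a subset of $G$ generating $G$ and $a\in A$ implies $a^{-1}\in A$ (the identity element is allowed to belong to $A$). $A^*$ denotes the set of all finite words over the alphabet $A$, including the empty word. A word $w\in A^*$ is geodesic if it labels a path of minimal length between two vertices of the Cayley graph of $G$ over $A$; equivalently, no strictly shorter word over $A$ represents the same element of $G$ as $w$. The geodesic language $\mathsf{Geo}(G,A)\subseteq A^*$ is the set of all geodesic words. A word $a_1a_2\cdots a_n$ ($a_i\in A$) is a piecewise subword of $w\in A^*$ if $w=w_0a_1w_1a_2\cdots a_nw_n$ for some $w_i\in A^*$ (i.e. it is a not necessarily contiguous subsequence of $w$). A language $L\subseteq A^*$ is piecewise excluding if there is a finite set $F\subset A^*$ such that, for all $w\in A^*$, $w\in L$ if and only if $w$ contains no piecewise subword in $F$. *)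

theory Defs
  imports "HOL-Algebra.Algebra" "HOL-Library.Sublist"
begin

text \<open>The library's \<^const>\<open>short_exact_sequence\<close> forces all three groups to have the same
  element type; the following is its heterogeneous version.\<close>

definition group_extension ::
  "('h, 'm) monoid_scheme \<Rightarrow> ('h \<Rightarrow> 'g) \<Rightarrow> ('g, 'n) monoid_scheme \<Rightarrow> ('g \<Rightarrow> 'k) \<Rightarrow>
    ('k, 'l) monoid_scheme \<Rightarrow> bool"
  where "group_extension H \<iota> G \<pi> K \<longleftrightarrow>
    group H \<and> group G \<and> group K \<and>
    \<iota> \<in> mon H G \<and> \<pi> \<in> epi G K \<and> \<iota> ` carrier H = kernel G K \<pi>"

lemma group_extension_iff_short_exact_sequence:
  fixes H G K :: "'a monoid"
  shows "group_extension H \<iota> G \<pi> K \<longleftrightarrow> short_exact_sequence K G H \<pi> \<iota>"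
  unfolding group_extension_def short_exact_sequence_iff
  by (auto simp: group_hom_def group_hom_axioms_def mon_def epi_def)

definition finitely_generated :: "('a, 'm) monoid_scheme \<Rightarrow> bool"
  where "finitely_generated G \<longleftrightarrow>
    (\<exists>S. finite S \<and> S \<subseteq> carrier G \<and> generate G S = carrier G)"

definition symmetric_generating_set :: "('a, 'm) monoid_scheme \<Rightarrow> 'a set \<Rightarrow> bool"
  where "symmetric_generating_set G A \<longleftrightarrow>
    A \<subseteq> carrier G \<and> generate G A = carrier G \<and> (\<forall>a\<in>A. inv\<^bsub>G\<^esub> a \<in> A)"

text \<open>\<open>cayley_path G A g w h\<close>: the word \<open>w\<close> over \<open>A\<close> labels a path from \<open>g\<close> to \<open>h\<close> in the
  Cayley graph, whose edges are \<open>x \<rightarrow> x \<otimes> a\<close> with label \<open>a \<in> A\<close>.\<close>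

inductive cayley_path ::
  "('a, 'm) monoid_scheme \<Rightarrow> 'a set \<Rightarrow> 'a \<Rightarrow> 'a list \<Rightarrow> 'a \<Rightarrow> bool"
  for G and A where
  Nil: "g \<in> carrier G \<Longrightarrow> cayley_path G A g [] g"
| Cons: "\<lbrakk>g \<in> carrier G; a \<in> A; cayley_path G A (g \<otimes>\<^bsub>G\<^esub> a) w h\<rbrakk>
    \<Longrightarrow> cayley_path G A g (a # w) h"

definition geodesic :: "('a, 'm) monoid_scheme \<Rightarrow> 'a set \<Rightarrow> 'a list \<Rightarrow> bool"
  where "geodesic G A w \<longleftrightarrow>
    (\<exists>g h. cayley_path G A g w h \<and> (\<forall>v. cayley_path G A g v h \<longrightarrow> length w \<le> length v))"

definition Geo :: "('a, 'm) monoid_scheme \<Rightarrow> 'a set \<Rightarrow> 'a list set"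
  where "Geo G A = {w \<in> lists A. geodesic G A w}"

definition piecewise_excluding :: "'a set \<Rightarrow> 'a list set \<Rightarrow> bool"
  where "piecewise_excluding A L \<longleftrightarrow>
    L \<subseteq> lists A \<and>
    (\<exists>F. finite F \<and> F \<subseteq> lists A \<and> (\<forall>w\<in>lists A. w \<in> L \<longleftrightarrow> \<not> (\<exists>u\<in>F. subseq u w)))"

text \<open>Geodesics in terms of the group elements represented by words.\<close>

definition word_value :: "('a, 'm) monoid_scheme \<Rightarrow> 'a list \<Rightarrow> 'a"
  where "word_value G w = foldr (\<otimes>\<^bsub>G\<^esub>) w \<one>\<^bsub>G\<^esub>"

lemma (in group) word_value_closed:
  assumes "A \<subseteq> carrier G" "w \<in> lists A"
  shows "word_value G w \<in> carrier G"
  using assms(2,1) unfolding word_value_def by (induction w) auto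

lemma (in group) cayley_path_iff:
  assumes "A \<subseteq> carrier G"
  shows "cayley_path G A g w h \<longleftrightarrow>
    g \<in> carrier G \<and> w \<in> lists A \<and> h = g \<otimes> word_value G w"
proof (induction w arbitrary: g)
  case Nil
  show ?case
    by (auto simp: word_value_def intro: cayley_path.Nil elim: cayley_path.cases)
next
  case (Cons a w)
  have "cayley_path G A g (a # w) h \<longleftrightarrow>
      g \<in> carrier G \<and> a \<in> A \<and> cayley_path G A (g \<otimes> a) w h"
    by (auto intro: cayley_path.Cons elim: cayley_path.cases)
  also have "\<dots> \<longleftrightarrow> g \<in> carrier G \<and> a # w \<in> lists A \<and> h = (g \<otimes> a) \<otimes> word_value G w"
    using Cons.IH assms by auto
  also have "\<dots> \<longleftrightarrow> g \<in> carrier G \<and> a # w \<in> lists A \<and> h = g \<otimes> word_value G (a # w)"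
  proof -
    have "(g \<otimes> a) \<otimes> word_value G w = g \<otimes> word_value G (a # w)"
      if "g \<in> carrier G" "a # w \<in> lists A"
      using that assms word_value_closed[OF assms, of w] m_assoc[of g a "word_value G w"]
      by (simp add: word_value_def subset_iff)
    then show ?thesis by metis
  qed
  finally show ?case .
qed

lemma (in group) Geo_iff:
  assumes "A \<subseteq> carrier G"
  shows "w \<in> Geo G A \<longleftrightarrow>
    w \<in> lists A \<and>
    \<not> (\<exists>v\<in>lists A. length v < length w \<and> word_value G v = word_value G w)"
proof
  assume "w \<in> Geo G A"
  then obtain g h where w: "w \<in> lists A" and p: "cayley_path G A g w h"
    and m: "\<And>v. cayley_path G A g v h \<Longrightarrow> length w \<le> length v"
    unfolding Geo_def geodesic_def by blast
  have "length w \<le> length v" if "v \<in> lists A" "word_value G v = word_value G w" for v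
    using m[of v] p that by (simp add: cayley_path_iff[OF assms])
  then show "w \<in> lists A \<and>
      \<not> (\<exists>v\<in>lists A. length v < length w \<and> word_value G v = word_value G w)"
    using w by (meson not_le)
next
  assume *: "w \<in> lists A \<and>
      \<not> (\<exists>v\<in>lists A. length v < length w \<and> word_value G v = word_value G w)"
  have "cayley_path G A \<one> w (word_value G w)"
    using * word_value_closed[OF assms, of w] by (simp add: cayley_path_iff[OF assms])
  moreover have "length w \<le> length v" if "cayley_path G A \<one> v (word_value G w)" for v
  proof -
    have v: "v \<in> lists A" "word_value G w = \<one> \<otimes> word_value G v"
      using that by (simp_all only: cayley_path_iff[OF assms])
    then have "word_value G v = word_value G w"
      using word_value_closed[OF assms v(1)] by simp
    then show ?thesis using * v(1) by (meson not_le)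
  qed
  ultimately show "w \<in> Geo G A"
    unfolding Geo_def geodesic_def using * by blast
qed

end

theory Submission
  imports Defs "HOL-Combinatorics.Multiset_Permutations"
begin

text \<open>Take for \<open>A\<close> the full preimage in \<open>G\<close> of a finite symmetric generating set of \<open>K\<close>
  containing the identity. As the letters of \<open>A\<close> may be changed freely within cosets of the kernel,
  a nonempty word over \<open>A\<close> can be corrected in its first letter to represent any element with the
  same image in \<open>K\<close>. Because \<open>K\<close> is abelian, it follows that geodesicity of a word depends only
  on its multiset of letters and passes to sub-multisets. By Dickson's lemma, finitely many
  minimal multisets have to be excluded.\<close>

section \<open>Dickson's lemma for finite multisets\<close>

lemma nat_seq_incseq_subseq:
  fixes s :: "nat \<Rightarrow> nat"
  shows "\<exists>r. strict_mono r \<and> incseq (s \<circ> r)"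
proof -
  obtain f where f: "strict_mono f" and mono: "monoseq (\<lambda>n. s (f n))"
    using seq_monosub by blast
  show ?thesis
  proof (cases "incseq (\<lambda>n. s (f n))")
    case True
    with f show ?thesis by (auto simp: o_def)
  next
    case False
    with mono have dec: "decseq (\<lambda>n. s (f n))"
      by (simp add: monoseq_iff)
    \<comment> \<open>A decreasing sequence of naturals is constant from the index \<open>k\<close>
      of its least value on; dropping the terms before \<open>k\<close> leaves a constant, hence
      increasing, sequence.\<close>
    obtain k where k: "\<And>n. s (f k) \<le> s (f n)"
      using ex_has_least_nat[of "\<lambda>_. True" 0 "\<lambda>n. s (f n)"] by auto
    have "s (f (n + k)) = s (f k)" for n
      using k[of "n + k"] decseqD[OF dec, of k "n + k"] by simp
    moreover have "strict_mono (\<lambda>n. f (n + k))"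
      using f by (simp add: strict_mono_def)
    ultimately show ?thesis
      by (intro exI[of _ "\<lambda>n. f (n + k)"]) (simp add: o_def)
  qed
qed

text \<open>The coordinates are treated one at a time: thinning the sequence further for a new
  coordinate keeps the earlier ones increasing.\<close>

lemma Dickson_incseq_subseq:
  fixes s :: "nat \<Rightarrow> 'a \<Rightarrow> nat"
  assumes "finite A"
  shows "\<exists>r. strict_mono r \<and> (\<forall>a\<in>A. incseq (\<lambda>n. s (r n) a))"
  using assms
proof (induction A rule: finite_induct)
  case empty
  show ?case by (intro exI[of _ id]) (simp add: strict_mono_def)
next
  case (insert a A)
  then obtain r where r: "strict_mono r" "\<And>b. b \<in> A \<Longrightarrow> incseq (\<lambda>n. s (r n) b)"
    by blast
  obtain q where q: "strict_mono q" "incseq ((\<lambda>n. s (r n) a) \<circ> q)"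
    using nat_seq_incseq_subseq by blast
  have "incseq (\<lambda>n. s (r (q n)) b)" if "b \<in> A" for b
    using r(2)[OF that] strict_mono_mono[OF q(1)] by (simp add: incseq_def mono_def)
  with q show ?case
    using strict_mono_o[OF r(1) q(1)] by (intro exI[of _ "r \<circ> q"]) (auto simp: o_def)
qed

text \<open>An infinite antichain would contain an injective sequence, and Dickson's lemma applied
  to its multiplicities yields two distinct comparable members.\<close>

lemma finite_multiset_antichain:
  assumes A: "finite A" and M: "\<And>m. m \<in> M \<Longrightarrow> set_mset m \<subseteq> A"
    and antichain: "\<And>m n. m \<in> M \<Longrightarrow> n \<in> M \<Longrightarrow> m \<subseteq># n \<Longrightarrow> m = n"
  shows "finite M"
proof (rule ccontr)
  assume "infinite M"
  then obtain s :: "nat \<Rightarrow> 'a multiset" where s: "inj s" "range s \<subseteq> M"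
    using infinite_countable_subset by blast
  obtain r where r: "strict_mono r" "\<And>a. a \<in> A \<Longrightarrow> incseq (\<lambda>n. count (s (r n)) a)"
    using Dickson_incseq_subseq[OF A, of "\<lambda>n. count (s n)"] by blast
  have "count (s (r 0)) a \<le> count (s (r 1)) a" for a
  proof (cases "a \<in> A")
    case True
    then show ?thesis using incseqD[OF r(2), of a 0 1] by simp
  next
    case False
    then have "a \<notin># s (r 0)" using M s(2) by blast
    then show ?thesis by (simp add: not_in_iff)
  qed
  then have "s (r 0) = s (r 1)"
    using antichain s(2) by (simp add: subseteq_mset_def range_subsetD)
  then have "r 0 = r 1" using s(1) by (simp add: inj_eq)
  then show False using r(1) by (simp add: strict_mono_eq)
qed

section \<open>Piecewise subwords and multisets of letters\<close>

lemma mset_subseteq_if_subseq: "subseq u w \<Longrightarrow> mset u \<subseteq># mset w"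
  by (induction rule: list_emb.induct) (simp_all add: subseteq_mset_def le_SucI)

lemma subseq_with_mset:
  assumes "m \<subseteq># mset w"
  shows "\<exists>u. subseq u w \<and> mset u = m"
  using assms
proof (induction w arbitrary: m)
  case Nil
  then show ?case by simp
next
  case (Cons a w)
  \<comment> \<open>If \<open>a\<close> does not occur in \<open>m\<close>, the difference is
    \<open>m\<close> itself, so one appeal to the induction hypothesis serves both cases
    below.\<close>
  have "m - {#a#} \<subseteq># mset w"
    using Cons.prems by (simp add: subset_eq_diff_conv)
  then obtain u where u: "subseq u w" "mset u = m - {#a#}" using Cons.IH by blast
  show ?case
  proof (cases "a \<in># m")
    case True
    with u show ?thesis by (intro exI[of _ "a # u"]) simp
  next
    case False
    with u show ?thesis
      by (intro exI[of _ u]) (simp add: diff_single_trivial list_emb_Cons)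
  qed
qed

text \<open>As \<open>closed\<close> covers equal multisets, membership in \<open>L\<close> is
  invariant under permuting letters. The words outside \<open>L\<close> thus correspond to an upward
  closed family of multisets over \<open>A\<close>, which is determined by its minimal members, an
  antichain.\<close>

lemma piecewise_excluding_if_mset_closed:
  assumes A: "finite A" and L: "L \<subseteq> lists A"
    and closed: "\<And>u w. w \<in> L \<Longrightarrow> mset u \<subseteq># mset w \<Longrightarrow> u \<in> L"
  shows "piecewise_excluding A L"
proof -
  define N where "N = mset ` (lists A - L)"
  define M where "M = {m \<in> N. \<forall>n\<in>N. n \<subseteq># m \<longrightarrow> n = m}"
  \<comment> \<open>Every ordering of a minimal multiset is listed, because \<open>subseq\<close>
    respects the order of letters, which the multiset forgets.\<close>
  define F where "F = (\<Union>m\<in>M. permutations_of_multiset m)"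
  have "set_mset m \<subseteq> A" if "m \<in> M" for m
    using that by (auto simp: M_def N_def)
  then have "finite M"
    by (rule finite_multiset_antichain[OF A]) (auto simp: M_def)
  then have "finite F" by (simp add: F_def)
  have F: "u \<in> lists A - L" if "u \<in> F" for u
  proof -
    have "mset u \<in> N"
      using that by (auto simp: F_def M_def permutations_of_multiset_def)
    then obtain v where "v \<in> lists A - L" "mset u = mset v"
      unfolding N_def by blast
    then have v: "v \<in> lists A" "v \<notin> L" "mset v = mset u" by simp_all
    then have "set u = set v" by (metis set_mset_mset)
    with v closed[of u v] show ?thesis by (auto simp: lists_eq_set)
  qed
  have "w \<in> L \<longleftrightarrow> \<not> (\<exists>u\<in>F. subseq u w)" if w: "w \<in> lists A" for w
  proof
    assume "w \<in> L"
    then show "\<not> (\<exists>u\<in>F. subseq u w)"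
      using F closed mset_subseteq_if_subseq by blast
  next
    assume nex: "\<not> (\<exists>u\<in>F. subseq u w)"
    show "w \<in> L"
    proof (rule ccontr)
      assume "w \<notin> L"
      with w have "mset w \<in> N \<and> mset w \<subseteq># mset w" by (simp add: N_def)
      \<comment> \<open>Least size forces minimality for inclusion, since a proper submultiset of
        \<open>m\<close> is smaller and still lies below \<open>mset w\<close>.\<close>
      then obtain m where m: "m \<in> N" "m \<subseteq># mset w"
        and least: "\<And>n. n \<in> N \<Longrightarrow> n \<subseteq># mset w \<Longrightarrow> size m \<le> size n"
        using ex_has_least_nat[of "\<lambda>m. m \<in> N \<and> m \<subseteq># mset w" "mset w" size] by blast
      have "n = m" if "n \<in> N" "n \<subseteq># m" for n
        using that m(2) least[of n]
        by (metis leD mset_subset_size subset_mset.le_imp_less_or_eq subset_mset.order_trans)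
      with m(1) have "m \<in> M" by (simp add: M_def)
      moreover obtain u where "subseq u w" "mset u = m"
        using subseq_with_mset m(2) by blast
      ultimately show False
        using nex by (auto simp: F_def permutations_of_multiset_def)
    qed
  qed
  moreover have "F \<subseteq> lists A" using F by blast
  ultimately show ?thesis
    unfolding piecewise_excluding_def using \<open>finite F\<close> L by (intro conjI exI[of _ F]) auto
qed

section \<open>Word values and full preimages under a homomorphism\<close>

lemma (in group) word_value_append:
  assumes "set u \<subseteq> carrier G" "set v \<subseteq> carrier G"
  shows "word_value G (u @ v) = word_value G u \<otimes> word_value G v"
  using assms
proof (induction u)
  case Nil
  then show ?case by (simp add: word_value_def)
next
  case (Cons a u)
  then show ?case by (simp add: word_value_def m_assoc)
qed

lemma (in group_hom) hom_word_value:
  assumes "set w \<subseteq> carrier G"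
  shows "h (word_value G w) = word_value H (map h w)"
  using assms
proof (induction w)
  case Nil
  then show ?case by (simp add: word_value_def)
next
  case (Cons a w)
  then show ?case by (simp add: word_value_def)
qed

text \<open>Each nonempty fibre of \<open>h\<close> is a left coset of the kernel, so the preimage
  is a finite union of finite sets.\<close>

lemma (in group_hom) finite_vimage_if_finite_kernel:
  assumes "finite (kernel G H h)" "finite B"
  shows "finite {g \<in> carrier G. h g \<in> B}"
proof -
  have "finite {g \<in> carrier G. h g = b}" for b
  proof (cases "\<exists>g0\<in>carrier G. h g0 = b")
    case True
    then obtain g0 where g0: "g0 \<in> carrier G" "h g0 = b" by blast
    have "g \<in> (\<otimes>) g0 ` kernel G H h" if "g \<in> carrier G" "h g = b" for g
    proof
      show "g = g0 \<otimes> (inv g0 \<otimes> g)"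
        using that g0 by (simp add: G.m_assoc[symmetric])
      show "inv g0 \<otimes> g \<in> kernel G H h"
        using that g0 H.l_inv[of b] hom_closed[of g0] by (simp add: kernel_def)
    qed
    then show ?thesis
      using assms(1) by (blast intro: finite_subset)
  next
    case False
    then show ?thesis by (auto intro: finite_subset[of _ "{}"])
  qed
  then have "finite (\<Union>b\<in>B. {g \<in> carrier G. h g = b})"
    using assms(2) by blast
  then show ?thesis
    by (rule rev_finite_subset) blast
qed

lemma (in group_hom) generate_vimage:
  assumes surj: "h ` carrier G = carrier H" and B: "B \<subseteq> carrier H" "\<one>\<^bsub>H\<^esub> \<in> B"
    and gen: "generate H B = carrier H" and sym: "\<And>b. b \<in> B \<Longrightarrow> inv\<^bsub>H\<^esub> b \<in> B"
  shows "generate G {g \<in> carrier G. h g \<in> B} = carrier G"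
proof
  let ?A = "{g \<in> carrier G. h g \<in> B}"
  show "generate G ?A \<subseteq> carrier G"
    by (rule G.generate_incl) blast
  \<comment> \<open>Quantifying over all preimages \<open>g\<close> of \<open>k\<close> avoids
    separate work on the kernel. In the base cases \<open>g\<close> is itself a letter, by the
    closure properties of \<open>B\<close>; in the product case any preimage \<open>g1\<close> of
    the first factor leaves \<open>inv g1 \<otimes> g\<close> over the second.\<close>
  have lift: "g \<in> generate G ?A" if "k \<in> generate H B" "g \<in> carrier G" "h g = k" for k g
    using that
  proof (induction k arbitrary: g rule: generate.induct)
    case one
    then show ?case using B(2) by (auto intro!: generate.incl)
  next
    case (incl b)
    then show ?case by (auto intro!: generate.incl)
  next
    case (inv b)
    then show ?case using sym B(1) by (auto intro!: generate.incl)
  next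
    case (eng k1 k2)
    have "k1 \<in> carrier H" "k2 \<in> carrier H"
      using eng.hyps gen by auto
    then obtain g1 where g1: "g1 \<in> carrier G" "h g1 = k1"
      using surj by (metis imageE)
    have "h (inv g1 \<otimes> g) = k2"
      using g1 eng.prems \<open>k1 \<in> carrier H\<close> \<open>k2 \<in> carrier H\<close>
      by (simp add: H.m_assoc[symmetric])
    then have "inv g1 \<otimes> g \<in> generate G ?A"
      using g1 eng.prems by (intro eng.IH(2)) simp_all
    then have "g1 \<otimes> (inv g1 \<otimes> g) \<in> generate G ?A"
      using generate.eng eng.IH(1)[OF g1] by metis
    moreover have "g1 \<otimes> (inv g1 \<otimes> g) = g"
      using g1 eng.prems by (simp add: G.m_assoc[symmetric])
    ultimately show ?case by simp
  qed
  show "carrier G \<subseteq> generate G ?A"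
  proof
    fix g assume "g \<in> carrier G"
    then show "g \<in> generate G ?A"
      using lift[OF _ _ refl, of g] gen by simp
  qed
qed

section \<open>Geodesics over a full preimage\<close>

text \<open>If \<open>t\<close> completes \<open>u\<close> to a rearrangement of \<open>w\<close>,
  and \<open>v\<close> represents the same element as \<open>u\<close>, then \<open>v @ t\<close>
  has the same image in the abelian quotient as \<open>w\<close>. The geodesic \<open>w\<close> is
  no longer than any nonempty word with that image, and cancelling the length of \<open>t\<close>
  bounds \<open>u\<close> by \<open>v\<close>.\<close>

lemma (in group_hom) Geo_vimage_mset_closed:
  assumes comm: "comm_group H" and B: "\<one>\<^bsub>H\<^esub> \<in> B"
    and A: "A = {g \<in> carrier G. h g \<in> B}"
    and w: "w \<in> Geo G A" and uw: "mset u \<subseteq># mset w"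
  shows "u \<in> Geo G A"
proof -
  have Acarr: "A \<subseteq> carrier G" using A by blast
  have wA: "w \<in> lists A"
    and least: "\<And>v. v \<in> lists A \<Longrightarrow> word_value G v = word_value G w \<Longrightarrow> length w \<le> length v"
    using w by (auto simp: G.Geo_iff[OF Acarr] not_less)
  have wv_closed: "word_value G v \<in> carrier G" if "v \<in> lists A" for v
    using G.word_value_closed[OF Acarr that] .
  have carr: "set v \<subseteq> carrier G" if "v \<in> lists A" for v
    using that Acarr by auto
  have lift: "length w \<le> length v"
    if v: "v \<in> lists A" "v \<noteq> []" "h (word_value G v) = h (word_value G w)" for v
  proof -
    obtain a v' where av: "v = a # v'" using v(2) by (cases v) auto
    let ?x = "word_value G v'"
    \<comment> \<open>The letter replacing \<open>a\<close> so that the word represents exactly the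
      same element as \<open>w\<close>. It has the same image as \<open>a\<close>, hence lies in
      \<open>A\<close>, and the length is unchanged.\<close>
    let ?b = "word_value G w \<otimes> inv ?x"
    have a: "a \<in> A" and v': "v' \<in> lists A" using v(1) av by auto
    have x: "?x \<in> carrier G" and y: "word_value G w \<in> carrier G"
      using wv_closed v' wA by auto
    have ac: "a \<in> carrier G" using a Acarr by blast
    have "h (word_value G w) = h a \<otimes>\<^bsub>H\<^esub> h ?x"
      using v(3) av ac x by (simp add: word_value_def)
    then have "h ?b = h a"
      using x y ac by (simp add: H.m_assoc)
    then have "?b \<in> A" using a x y by (simp add: A)
    moreover have "word_value G (?b # v') = word_value G w"
      using x y by (simp add: word_value_def G.m_assoc)
    ultimately show ?thesis
      using least[of "?b # v'"] v' av by simp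
  qed
  \<comment> \<open>The empty word has no letter to correct, so over the identity the comparison is
    with a word of length one, whose letter belongs to \<open>A\<close> because \<open>B\<close>
    contains the identity.\<close>
  have kernel: "length w \<le> 1" if "h (word_value G w) = \<one>\<^bsub>H\<^esub>"
    using lift[of "[\<one>]"] that B by (simp add: A word_value_def)
  have "set u \<subseteq> set w" using uw by (metis set_mset_mset set_mset_mono)
  then have uA: "u \<in> lists A" using wA by auto
  have "length u \<le> length v"
    if vA: "v \<in> lists A" and vu: "word_value G v = word_value G u" for v
  proof -
    obtain t where t: "mset w = mset (u @ t)"
      using uw by (metis ex_mset mset_append subset_mset.le_iff_add)
    have "set t \<subseteq> set w" using t by (metis set_mset_mset set_append Un_upper2)
    then have tA: "t \<in> lists A" using wA by auto
    \<comment> \<open>Commutativity enters here: the image of a word value does not depend on the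
      order of the letters.\<close>
    have perm: "h (word_value G w) = h (word_value G (u @ t))"
    proof -
      have "word_value H (map h w) = word_value H (map h (u @ t))"
        unfolding word_value_def
        using comm t carr[OF wA]
        by (intro comm_monoid.multlist_perm_cong) (auto simp: comm_group_def)
      then show ?thesis
        using carr wA uA tA by (simp add: hom_word_value)
    qed
    have eq: "word_value G (v @ t) = word_value G (u @ t)"
      using vu carr uA vA tA by (simp add: G.word_value_append)
    have len: "length w = length u + length t"
      using t by (metis length_append size_mset)
    show ?thesis
    proof (cases "v @ t = []")
      case False
      then show ?thesis
        using lift[of "v @ t"] perm eq len vA tA by auto
    next
      case True
      \<comment> \<open>Here \<open>lift\<close> does not apply, as \<open>v @ t\<close> is empty.
        But then \<open>w\<close> and \<open>u\<close> have the same letters and length at most one,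
        so they coincide.\<close>
      then have "h (word_value G w) = \<one>\<^bsub>H\<^esub>"
        using perm eq by (simp add: word_value_def)
      then have "length w \<le> 1" by (rule kernel)
      moreover have "mset w = mset u" using t True by simp
      ultimately have "w = u"
        by (cases w) auto
      then show ?thesis using least[OF vA] vu by simp
    qed
  qed
  then show ?thesis
    using uA by (auto simp: G.Geo_iff[OF Acarr] not_less)
qed

theorem proposition3p3:
  fixes H :: "('h, 'm) monoid_scheme" and G :: "('g, 'n) monoid_scheme"
    and K :: "('k, 'l) monoid_scheme"
    and \<iota> :: "'h \<Rightarrow> 'g" and \<pi> :: "'g \<Rightarrow> 'k"
  assumes "comm_group K" and "finitely_generated K"
    and "group H" and "finite (carrier H)"
    and "group_extension H \<iota> G \<pi> K"
  shows "\<exists>A. finite A \<and> symmetric_generating_set G A \<and> piecewise_excluding A (Geo G A)"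
proof -
  have hom: "\<pi> \<in> hom G K" and surj: "\<pi> ` carrier G = carrier K"
    and ker: "\<iota> ` carrier H = kernel G K \<pi>" and groups: "group G" "group K"
    using assms(5) by (auto simp: group_extension_def epi_def)
  interpret K: group K by fact
  interpret group_hom G K \<pi>
    using groups hom by (simp add: group_hom_def group_hom_axioms_def)
  obtain S where S: "finite S" "S \<subseteq> carrier K" "generate K S = carrier K"
    using assms(2) by (auto simp: finitely_generated_def)
  \<comment> \<open>Adding inverses makes \<open>A\<close> symmetric; adding the identity puts the
    whole kernel into \<open>A\<close>, as needed for generation and for geodesics representing
    kernel elements.\<close>
  define B where "B = insert \<one>\<^bsub>K\<^esub> (S \<union> m_inv K ` S)"
  define A where "A = {g \<in> carrier G. \<pi> g \<in> B}"
  have B: "finite B" "B \<subseteq> carrier K" "\<one>\<^bsub>K\<^esub> \<in> B"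
    using S by (auto simp: B_def)
  have sym: "inv\<^bsub>K\<^esub> b \<in> B" if "b \<in> B" for b
    using that S(2) by (auto simp: B_def)
  have "S \<subseteq> B" by (auto simp: B_def)
  then have "generate K B = carrier K"
    using K.mono_generate[of S B] K.generate_incl[OF B(2)] S(3) by blast
  then have "generate G A = carrier G"
    unfolding A_def using generate_vimage surj B sym by blast
  then have "symmetric_generating_set G A"
    using sym by (auto simp: symmetric_generating_set_def A_def)
  \<comment> \<open>The kernel is the image of the finite group \<open>H\<close>, so the fibres over
    the finite set \<open>B\<close> are finite.\<close>
  moreover have finA: "finite A"
    unfolding A_def using finite_vimage_if_finite_kernel ker assms(4) B(1)
    by (metis finite_imageI)
  moreover have "piecewise_excluding A (Geo G A)"
    using finA
  proof (rule piecewise_excluding_if_mset_closed)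
    show "Geo G A \<subseteq> lists A" by (auto simp: Geo_def)
    show "u \<in> Geo G A" if "w \<in> Geo G A" "mset u \<subseteq># mset w" for u w
      using Geo_vimage_mset_closed[OF assms(1) B(3) A_def that] .
  qed
  ultimately show ?thesis by blast
qed

end
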